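(* Let $n$, $m$ and $k$ be nonnegative integers. Define: (1) $\mathrm{ped}(n,m,k)$: the number of partitions $\lambda$ of $n$ in which the even parts are distinct (odd parts are unrestricted), having exactly $m$ parts in total, exactly $k$ of which are even. (2) $F(n,m,k)$: the number of partitions $\lambda\in\mathscr{F}(n)$ with $\ell_1(\lambda)=m$ and $\overline{\ell}_o(\lambda)=k$, where $\mathscr{F}(n)$, $\ell_1$ and $\overline{\ell}_o$ are as defined in the context. (3) $F_{-1}(n,m,k)$: the number of signed partitions $\sigma=(\pi,\nu)$ of $n$ such that the positive parts are even and distinct, the negative parts are odd, distinct and at most $2\ell^+(\sigma)-1$, and moreover $\ell^+(\sigma)=m$ and $\ell^+(\sigma)-\ell^-(\sigma)=k$. Then $$\mathrm{ped}(n,m,k)=F(n,m,k)=F_{-1}(n,m,k).$$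
   Context: A partition $\lambda$ of a nonnegative integer $n$ is a nonincreasing finite sequence of positive integers (its parts) with sum $|\lambda|=n$; $\ell(\lambda)$ is the number of parts. The empty partition is the unique partition of $0$. $\mathscr{F}(n)$ is the set of partitions $\lambda$ of $n$ where the smallest part is $1$, the first occurrence of $1$ may be overlined, each part is at most twice the number of occurrences of $1$, and the remaining odd parts (odd parts other than $1$) are not repeated. Here $\overline{1}$ is treated as a part of size $1$ distinguished from the ordinary (non-overlined) parts $1$: it appears at most once, and "the number of occurrences of $1$" counts only the ordinary, non-overlined $1$'s. Equivalently, an element of $\mathscr{F}(n)$ consists of: $j\ge 0$ ordinary $1$'s; at most one $\overline{1}$ (allowed only if $j\ge 1$); odd parts from $\{3,5,\dots,2j-1\}$, each used at most once; and even parts from $\{2,4,\dots,2j\}$ with arbitrary multiplicities; with total sum $n$. By convention the empty partition (the case $j=0$) is the unique element of $\mathscr{F}(0)$. For $\lambda\in\mathscr{F}(n)$, $\ell_1(\lambda)$ is the number of (ordinary, non-overlined) parts equal to $1$, and $\overline{\ell}_o(\lambda)$ is the number of odd parts other than $1$, plus one if $\overline{1}$ is present. A signed partition $\sigma$ of $n$ is a pair $(\pi,\nu)$ of (possibly empty) partitions with $|\pi|-|\nu|=n$. The parts of $\pi$ are the positive parts and the parts of $\nu$ are the negative parts of $\sigma$; $\ell^+(\sigma)=\ell(\pi)$ and $\ell^-(\sigma)=\ell(\nu)$. *)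

theory Defs
  imports Main
begin

definition is_partition :: "nat list \<Rightarrow> nat \<Rightarrow> bool" where
  "is_partition \<mu> n \<longleftrightarrow>
     sorted_wrt (\<ge>) \<mu> \<and> (\<forall>p\<in>set \<mu>. p > 0) \<and> sum_list \<mu> = n"

definition ped :: "nat \<Rightarrow> nat \<Rightarrow> nat \<Rightarrow> nat" where
  "ped n m k = card {\<mu>. is_partition \<mu> n \<and> distinct (filter even \<mu>) \<and>
                         length \<mu> = m \<and> length (filter even \<mu>) = k}"

text \<open>
  A partition in which one part 1 may be overlined is a pair \<open>(b, \<mu>)\<close>: \<open>\<mu>\<close> lists the ordinary
  parts, and \<open>b\<close> says whether the overlined 1, which has size 1 and is not listed in \<open>\<mu>\<close>, is
  present. Hence \<open>count_list \<mu> 1\<close> counts the ordinary 1's only. The conditions below admit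
  \<open>(False, [])\<close>, the empty partition, as the only element without ordinary 1's.
\<close>

definition \<F> :: "nat \<Rightarrow> (bool \<times> nat list) set" where
  "\<F> n = {(b, \<mu>).
     (\<exists>s. is_partition \<mu> s \<and> s + of_bool b = n) \<and>
     (b \<or> \<mu> \<noteq> [] \<longrightarrow> 1 \<in> set \<mu>) \<and>
     (\<forall>p\<in>set \<mu>. p \<le> 2 * count_list \<mu> 1) \<and>
     distinct (filter (\<lambda>p. odd p \<and> p \<noteq> 1) \<mu>)}"

definition ell_1 :: "bool \<times> nat list \<Rightarrow> nat" where
  "ell_1 = (\<lambda>(b, \<mu>). count_list \<mu> 1)"

definition ell_o_bar :: "bool \<times> nat list \<Rightarrow> nat" where
  "ell_o_bar = (\<lambda>(b, \<mu>). length (filter (\<lambda>p. odd p \<and> p \<noteq> 1) \<mu>) + of_bool b)"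

definition F :: "nat \<Rightarrow> nat \<Rightarrow> nat \<Rightarrow> nat" where
  "F n m k = card {\<phi> \<in> \<F> n. ell_1 \<phi> = m \<and> ell_o_bar \<phi> = k}"

definition signed_partition :: "nat list \<times> nat list \<Rightarrow> int \<Rightarrow> bool" where
  "signed_partition = (\<lambda>(\<pi>, \<nu>) n.
     \<exists>a b. is_partition \<pi> a \<and> is_partition \<nu> b \<and> int a - int b = n)"

definition F_neg1 :: "nat \<Rightarrow> nat \<Rightarrow> nat \<Rightarrow> nat" where
  "F_neg1 n m k = card {(\<pi>, \<nu>). signed_partition (\<pi>, \<nu>) (int n) \<and>
     (\<forall>p\<in>set \<pi>. even p) \<and> distinct \<pi> \<and>
     (\<forall>p\<in>set \<nu>. odd p \<and> int p \<le> 2 * int (length \<pi>) - 1) \<and> distinct \<nu> \<and>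
     length \<pi> = m \<and> int (length \<pi>) - int (length \<nu>) = int k}"

end

theory Submission
  imports Defs
begin

text \<open>
  All three counts satisfy one recurrence in the number \<open>m\<close>. It is the coefficient form of
  \<open>(1 - q\<^bsup>2m+2\<^esup>) c\<^bsub>m+1\<^esub> = (q + t q\<^bsup>2m+2\<^esup>) c\<^bsub>m\<^esub>\<close>, which encodes
  \<open>c\<^bsub>m\<^esub> = q\<^bsup>m\<^esup> (-tq; q\<^bsup>2\<^esup>)\<^bsub>m\<^esub> / (q\<^bsup>2\<^esup>; q\<^bsup>2\<^esup>)\<^bsub>m\<^esub>\<close>. The three terms of the
  recurrence correspond to a partition of each set into three classes. For partitions with
  distinct even parts, look at the smallest part: if it is 1, remove it; if it is 2, remove it
  and subtract 2 from the other parts; otherwise subtract 2 from all parts. In \<open>\<F>\<close>, remove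
  a largest possible part \<open>2m+2\<close>, or else the part \<open>2m+1\<close> (the overlined 1 if \<open>m = 0\<close>) and a 1, or
  else just a 1. For signed partitions, subtract 2 from the positive parts and drop a zero if
  one arises, together with the negative part \<open>2m+1\<close> if it is present.
\<close>

section \<open>The common recurrence and the counting principle built on it\<close>

function rec_count :: "int \<Rightarrow> nat \<Rightarrow> int \<Rightarrow> nat" where
  "rec_count n 0 k = of_bool (n = 0 \<and> k = 0)"
| "rec_count n (Suc m) k = (if n < 0 then 0 else
     rec_count (n - 1) m k + rec_count (n - 2 * int (Suc m)) (Suc m) k
     + rec_count (n - 2 * int (Suc m)) m (k - 1))"
  by pat_completeness auto
termination
  \<comment> \<open>Recursive calls occur only for \<open>n \<ge> 0\<close>; the \<open>+ 1\<close>
    makes the measure drop even from \<open>n = 0\<close> to \<open>n = -1\<close>.\<close>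
  by (relation "measure (\<lambda>(n, m, k). nat (n + 1))") auto

text \<open>The injective maps identify three disjoint classes with earlier sets of the family, so
  cardinalities add up as in the recurrence. Finiteness is carried through the same induction
  because additivity of \<open>card\<close> needs it.\<close>

lemma card_eq_rec_count:
  fixes S :: "int \<Rightarrow> nat \<Rightarrow> int \<Rightarrow> 'a set"
  assumes neg: "\<And>n m k. n < 0 \<Longrightarrow> S n m k = {}"
    and zero: "\<And>n k. S n 0 k = (if n = 0 \<and> k = 0 then {x0} else {})"
    and step: "\<And>n m k. S n (Suc m) k = f m ` S (n - 1) m k
      \<union> g m ` S (n - 2 * int (Suc m)) (Suc m) k \<union> h m ` S (n - 2 * int (Suc m)) m (k - 1)"
    and inj: "\<And>n m k. inj_on (f m) (S n m k)" "\<And>n m k. inj_on (g m) (S n (Suc m) k)"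
      "\<And>n m k. inj_on (h m) (S n m k)"
    and disj: "\<And>n n' m k k'. f m ` S n m k \<inter> g m ` S n' (Suc m) k' = {}"
      "\<And>n n' m k k'. f m ` S n m k \<inter> h m ` S n' m k' = {}"
      "\<And>n n' m k k'. g m ` S n (Suc m) k \<inter> h m ` S n' m k' = {}"
  shows "finite (S n m k) \<and> card (S n m k) = rec_count n m k"
proof (induction n m k rule: rec_count.induct)
  case (1 n k)
  then show ?case by (simp add: zero)
next
  case (2 n m k)
  show ?case
  proof (cases "n < 0")
    case True
    then show ?thesis by (simp add: neg)
  next
    case False
    let ?A = "f m ` S (n - 1) m k"
    let ?B = "g m ` S (n - 2 * int (Suc m)) (Suc m) k"
    let ?C = "h m ` S (n - 2 * int (Suc m)) m (k - 1)"
    note IH = 2[OF False]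
    have fin: "finite ?A" "finite ?B" "finite ?C"
      using IH by blast+
    have "card (?A \<union> ?B \<union> ?C) = card ?A + card ?B + card ?C"
      using fin disj by (simp add: card_Un_disjoint Int_Un_distrib2 del: of_nat_Suc)
    also have "\<dots> = rec_count n (Suc m) k"
      using IH False by (simp add: card_image inj del: of_nat_Suc)
    finally show ?thesis
      using fin unfolding step[of n m k] by blast
  qed
qed

section \<open>Adding 2 to every part\<close>

definition shift :: "nat list \<Rightarrow> nat list" where
  "shift xs = map (\<lambda>p. p + 2) xs"

lemma length_shift [simp]: "length (shift xs) = length xs"
  and set_shift [simp]: "set (shift xs) = (\<lambda>p. p + 2) ` set xs"
  and distinct_shift [simp]: "distinct (shift xs) \<longleftrightarrow> distinct xs"
  and sorted_wrt_shift [simp]: "sorted_wrt (\<ge>) (shift xs) \<longleftrightarrow> sorted_wrt (\<ge>) xs"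
  by (auto simp: shift_def sorted_wrt_map distinct_map inj_on_def)

lemma sum_list_shift [simp]: "sum_list (shift xs) = sum_list xs + 2 * length xs"
  and filter_even_shift [simp]: "filter even (shift xs) = shift (filter even xs)"
  by (induction xs) (auto simp: shift_def)

lemma shift_eq_iff [simp]: "shift xs = shift ys \<longleftrightarrow> xs = ys"
  unfolding shift_def by (intro inj_map_eq_map) (simp add: inj_def)

lemma shift_preimage:
  assumes "\<forall>p\<in>set xs. p \<ge> 3"
  obtains ys where "xs = shift ys" "\<forall>p\<in>set ys. p > 0"
proof
  show "xs = shift (map (\<lambda>p. p - 2) xs)"
    using assms by (induction xs) (auto simp: shift_def)
  show "\<forall>p\<in>set (map (\<lambda>p. p - 2) xs). p > 0"
    using assms by auto
qed

text \<open>Shifted positive parts are at least 3, so a final 1 or 2 marks a list outside the image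
  of \<open>shift\<close>. This separates classes of the recurrence.\<close>

lemma shift_neq_append:
  assumes "\<forall>p\<in>set xs. p > 0" "x \<le> 2"
  shows "shift xs \<noteq> ys @ [x]"
proof
  assume "shift xs = ys @ [x]"
  then have "x \<in> set (shift xs)" by simp
  then show False using assms by auto
qed

section \<open>Partitions with distinct even parts\<close>

text \<open>With integer \<open>n\<close> and \<open>k\<close>, arguments such as
  \<open>n - 1\<close> and \<open>k - 1\<close> may become negative, where the set is empty, instead
  of being truncated.\<close>

definition ped_set :: "int \<Rightarrow> nat \<Rightarrow> int \<Rightarrow> nat list set" where
  "ped_set n m k = {\<mu>. sorted_wrt (\<ge>) \<mu> \<and> (\<forall>p\<in>set \<mu>. p > 0) \<and> int (sum_list \<mu>) = n \<and>
     distinct (filter even \<mu>) \<and> length \<mu> = m \<and> int (length (filter even \<mu>)) = k}"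

lemma ped_set_add1: "\<mu> @ [1] \<in> ped_set n (Suc m) k \<longleftrightarrow> \<mu> \<in> ped_set (n - 1) m k"
  by (auto simp: ped_set_def sorted_wrt_append Suc_le_eq)

text \<open>Positivity excludes entries 0, which \<open>shift\<close> would turn into legitimate
  parts 2. The resulting equivalence serves both inclusions of \<open>ped_set_Suc\<close>.\<close>

lemma ped_set_add2:
  assumes "\<forall>p\<in>set \<mu>. p > 0"
  shows "shift \<mu> \<in> ped_set n m k \<longleftrightarrow> \<mu> \<in> ped_set (n - 2 * int m) m k"
  using assms
  by (auto simp: ped_set_def)

text \<open>Even parts of the shifted list are at least 4, so the new 2 leaves the even parts
  distinct.\<close>

lemma ped_set_add2_append2:
  assumes "\<forall>p\<in>set \<mu>. p > 0"
  shows "shift \<mu> @ [2] \<in> ped_set n (Suc m) k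
    \<longleftrightarrow> \<mu> \<in> ped_set (n - 2 * int (Suc m)) m (k - 1)"
  using assms
  by (auto simp: ped_set_def sorted_wrt_append)

lemma ped_set_pos: "\<mu> \<in> ped_set n m k \<Longrightarrow> \<forall>p\<in>set \<mu>. p > 0"
  by (simp add: ped_set_def)

lemma ped_set_Suc:
  "ped_set n (Suc m) k = (\<lambda>\<mu>. \<mu> @ [1]) ` ped_set (n - 1) m k
    \<union> shift ` ped_set (n - 2 * int (Suc m)) (Suc m) k
    \<union> (\<lambda>\<mu>. shift \<mu> @ [2]) ` ped_set (n - 2 * int (Suc m)) m (k - 1)"
  (is "?L = ?A \<union> ?B \<union> ?C")
proof
  show "?A \<union> ?B \<union> ?C \<subseteq> ?L"
    using ped_set_add1 ped_set_add2 ped_set_add2_append2 ped_set_pos by blast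
  show "?L \<subseteq> ?A \<union> ?B \<union> ?C"
  proof
    fix \<mu> assume \<mu>: "\<mu> \<in> ?L"
    then have "length \<mu> = Suc m" by (simp add: ped_set_def)
    \<comment> \<open>The list is nonincreasing, so its last entry \<open>x\<close> is the smallest
      part.\<close>
    then obtain xs x where xs: "\<mu> = xs @ [x]"
      by (cases \<mu> rule: rev_cases) auto
    have ge: "\<forall>p\<in>set xs. p \<ge> x" and "x > 0"
      using \<mu> by (auto simp: ped_set_def xs sorted_wrt_append)
    then consider "x = 1" | "x = 2" | "x \<ge> 3" by linarith
    then show "\<mu> \<in> ?A \<union> ?B \<union> ?C"
    proof cases
      case 1
      then show ?thesis using \<mu> ped_set_add1 xs by blast
    next
      case 2
      have "2 \<notin> set xs" using \<mu> by (auto simp: ped_set_def xs 2)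
      then have "\<forall>p\<in>set xs. p \<ge> 3"
        using ge 2 by (metis Suc_leI eval_nat_numeral(3) le_neq_implies_less)
      then show ?thesis
        using \<mu> ped_set_add2_append2 unfolding xs 2 by (elim shift_preimage) blast
    next
      case 3
      then have "\<forall>p\<in>set \<mu>. p \<ge> 3" using ge by (auto simp: xs)
      then show ?thesis
        using \<mu> ped_set_add2 by (elim shift_preimage) blast
    qed
  qed
qed

lemma card_ped_set: "card (ped_set n m k) = rec_count n m k"
proof -
  have "finite (ped_set n m k) \<and> card (ped_set n m k) = rec_count n m k"
  proof (rule card_eq_rec_count[where S = ped_set and f = "\<lambda>_ \<mu>. \<mu> @ [1]" and g = "\<lambda>_. shift"
        and h = "\<lambda>_ \<mu>. shift \<mu> @ [2]", OF _ _ ped_set_Suc])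
    fix n k m
    show "ped_set n m k = {}" if "n < 0"
      using that by (auto simp: ped_set_def)
    show "ped_set n 0 k = (if n = 0 \<and> k = 0 then {[]} else {})"
      by (auto simp: ped_set_def)
  next
    fix n n' k k' :: int and m :: nat
    have neq: "shift \<mu> \<noteq> xs @ [x]" if "\<mu> \<in> ped_set n m k" "x \<le> 2" for \<mu> xs x n m k
      using that by (intro shift_neq_append) (auto dest: ped_set_pos)
    show "(\<lambda>\<mu>. \<mu> @ [1]) ` ped_set n m k \<inter> shift ` ped_set n' (Suc m) k' = {}"
      using neq by (fastforce dest!: sym[of "_ @ _"])
    show "shift ` ped_set n (Suc m) k
        \<inter> (\<lambda>\<mu>. shift \<mu> @ [2]) ` ped_set n' m k' = {}"
      using neq by fastforce
  \<comment> \<open>The two remaining classes end in 1 and in 2 respectively, hence are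
    disjoint.\<close>
  qed (auto simp: inj_on_def)
  then show ?thesis ..
qed

lemma ped_eq_rec_count: "ped n m k = rec_count (int n) m (int k)"
proof -
  have "{\<mu>. is_partition \<mu> n \<and> distinct (filter even \<mu>) \<and> length \<mu> = m \<and>
      length (filter even \<mu>) = k} = ped_set (int n) m (int k)"
    by (auto simp: ped_set_def is_partition_def)
  then show ?thesis
    by (simp add: ped_def card_ped_set)
qed

section \<open>Partitions with bounded parts and overlined ones\<close>

text \<open>The number of ordinary 1's is \<open>m\<close>, so it can stand in the bound on the
  parts. The demand for an ordinary 1 becomes \<open>b \<longrightarrow> m > 0\<close>, since for
  \<open>m = 0\<close> the bounds \<open>0 < p \<le> 2 * m\<close> already force
  \<open>\<mu> = []\<close>.\<close>

definition F_set :: "int \<Rightarrow> nat \<Rightarrow> int \<Rightarrow> (bool \<times> nat list) set" where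
  "F_set n m k = {(b, \<mu>). sorted_wrt (\<ge>) \<mu> \<and> (\<forall>p\<in>set \<mu>. 0 < p \<and> p \<le> 2 * m) \<and>
     int (sum_list \<mu>) + of_bool b = n \<and> (b \<longrightarrow> m > 0) \<and> count_list \<mu> 1 = m \<and>
     distinct (filter (\<lambda>p. odd p \<and> p \<noteq> 1) \<mu>) \<and>
     int (length (filter (\<lambda>p. odd p \<and> p \<noteq> 1) \<mu>)) + of_bool b = k}"

definition F_add_one :: "bool \<times> nat list \<Rightarrow> bool \<times> nat list" where
  "F_add_one = (\<lambda>(b, \<mu>). (b, \<mu> @ [1]))"

definition F_add_even :: "nat \<Rightarrow> bool \<times> nat list \<Rightarrow> bool \<times> nat list" where
  "F_add_even m = (\<lambda>(b, \<mu>). (b, 2 * Suc m # \<mu>))"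

text \<open>Both branches add total size \<open>2 * m + 2\<close> and raise \<open>k\<close> by one.
  For \<open>m = 0\<close> the part \<open>2 * m + 1\<close> would be an ordinary 1, which
  \<open>k\<close> does not count, so the overlined 1 takes its place.\<close>

definition F_add_odd :: "nat \<Rightarrow> bool \<times> nat list \<Rightarrow> bool \<times> nat list" where
  "F_add_odd m = (\<lambda>(b, \<mu>). if m = 0 then (True, \<mu> @ [1]) else (b, Suc (2 * m) # \<mu> @ [1]))"

lemma F_set_0: "F_set n 0 k = (if n = 0 \<and> k = 0 then {(False, [])} else {})"
proof -
  have empty: "(\<forall>p\<in>set \<mu>. 0 < p \<and> p \<le> 2 * 0) \<longleftrightarrow> \<mu> = []" for \<mu> :: "nat list"
    by (cases \<mu>) auto
  have "\<phi> \<in> F_set n 0 k \<longleftrightarrow> \<phi> = (False, []) \<and> n = 0 \<and> k = 0" for \<phi>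
    unfolding F_set_def empty by (cases \<phi>) auto
  then show ?thesis by auto
qed

lemma F_add_one_in: "\<phi> \<in> F_set (n - 1) m k \<Longrightarrow> F_add_one \<phi> \<in> F_set n (Suc m) k"
  by (fastforce simp: F_set_def F_add_one_def sorted_wrt_append Suc_le_eq)

lemma F_add_even_in:
  "\<phi> \<in> F_set (n - 2 * int (Suc m)) (Suc m) k \<Longrightarrow> F_add_even m \<phi> \<in> F_set n (Suc m) k"
  by (auto simp: F_set_def F_add_even_def)

lemma F_add_odd_in:
  assumes "\<phi> \<in> F_set (n - 2 * int (Suc m)) m (k - 1)"
  shows "F_add_odd m \<phi> \<in> F_set n (Suc m) k"
proof (cases "m = 0")
  case True
  then show ?thesis
    using assms by (auto simp: F_set_0 split: if_splits) (auto simp: F_set_def F_add_odd_def)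
next
  case False
  then show ?thesis
    using assms by (fastforce simp: F_set_def F_add_odd_def sorted_wrt_append Suc_le_eq)
qed

lemma F_set_SucE:
  assumes "(b, \<mu>) \<in> F_set n (Suc m) k"
  obtains xs where "\<mu> = xs @ [1]"
proof (cases \<mu> rule: rev_cases)
  case Nil
  then show ?thesis using assms by (simp add: F_set_def)
next
  case (snoc xs x)
  have "count_list \<mu> 1 \<noteq> 0"
    using assms by (simp add: F_set_def)
  then have "1 \<in> set \<mu>"
    by (simp add: count_list_0_iff)
  then have "x = 1"
    using assms by (auto simp: F_set_def snoc sorted_wrt_append)
  then show ?thesis using that snoc by blast
qed

text \<open>The largest part decides the class: \<open>2 * m + 2\<close>, \<open>2 * m + 1\<close>,
  or at most \<open>2 * m\<close>. In the last two cases removing a 1 lowers the bound on the parts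
  to \<open>2 * m\<close>. For \<open>m = 0\<close> these two cases are told apart by the overlined
  1 instead.\<close>

lemma F_set_Suc:
  "F_set n (Suc m) k = F_add_one ` F_set (n - 1) m k
    \<union> F_add_even m ` F_set (n - 2 * int (Suc m)) (Suc m) k
    \<union> F_add_odd m ` F_set (n - 2 * int (Suc m)) m (k - 1)"
  (is "?L = ?A \<union> ?B \<union> ?C")
proof
  show "?A \<union> ?B \<union> ?C \<subseteq> ?L"
    using F_add_one_in F_add_even_in F_add_odd_in by blast
  show "?L \<subseteq> ?A \<union> ?B \<union> ?C"
  proof
    fix \<phi> assume \<phi>: "\<phi> \<in> ?L"
    obtain b \<mu> where b: "\<phi> = (b, \<mu>)" by force
    obtain xs where xs: "\<mu> = xs @ [1]"
      using \<phi> F_set_SucE unfolding b by blast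
    have bound: "\<forall>p\<in>set \<mu>. p \<le> hd \<mu>"
      using \<phi> by (cases \<mu>) (auto simp: b F_set_def)
    consider "hd \<mu> = 2 * Suc m" | "hd \<mu> = Suc (2 * m)" "m > 0" | "hd \<mu> \<le> 2 * m" "m > 0"
      | "hd \<mu> = 1" "m = 0"
    proof -
      have "0 < hd \<mu>" "hd \<mu> \<le> 2 * Suc m"
        using \<phi> hd_in_set[of \<mu>] by (auto simp: b F_set_def xs simp del: hd_append2 hd_append)
      then have "hd \<mu> = 2 * Suc m \<or> hd \<mu> = Suc (2 * m) \<or> hd \<mu> \<le> 2 * m" "0 < hd \<mu>"
        by auto
      then show ?thesis using that by (cases "m = 0") auto
    qed
    then show "\<phi> \<in> ?A \<union> ?B \<union> ?C"
    proof cases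
      case 1
      then obtain ys where ys: "\<mu> = 2 * Suc m # ys"
        by (cases \<mu>) (auto simp: xs)
      have "(b, ys) \<in> F_set (n - 2 * int (Suc m)) (Suc m) k"
        using \<phi> by (auto simp: b ys F_set_def)
      moreover have "\<phi> = F_add_even m (b, ys)"
        by (simp add: b ys F_add_even_def)
      ultimately show ?thesis by blast
    next
      case 2
      then obtain ys where ys: "\<mu> = Suc (2 * m) # ys @ [1]"
        by (cases xs) (auto simp: xs)
      \<comment> \<open>As \<open>m > 0\<close>, this part is odd and different from 1, so it is not
        repeated.\<close>
      have "Suc (2 * m) \<notin> set ys"
        using \<phi> 2 by (auto simp: b ys F_set_def)
      moreover have "\<forall>p\<in>set ys. p \<le> Suc (2 * m)"
        using bound by (auto simp: ys)
      ultimately have "\<forall>p\<in>set ys. p \<le> 2 * m"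
        by (metis le_SucE)
      then have "(b, ys) \<in> F_set (n - 2 * int (Suc m)) m (k - 1)"
        using \<phi> 2 by (auto simp: b ys F_set_def sorted_wrt_append)
      moreover have "\<phi> = F_add_odd m (b, ys)"
        using 2 by (simp add: b ys F_add_odd_def)
      ultimately show ?thesis by blast
    next
      case 3
      then have "\<forall>p\<in>set xs. p \<le> 2 * m"
        using bound by (auto simp: xs)
      then have "(b, xs) \<in> F_set (n - 1) m k"
        using \<phi> 3 by (auto simp: b xs F_set_def sorted_wrt_append)
      moreover have "\<phi> = F_add_one (b, xs)"
        by (simp add: b xs F_add_one_def)
      ultimately show ?thesis by blast
    next
      case 4
      \<comment> \<open>All parts equal 1 and there is exactly one ordinary 1, so
        \<open>\<mu> = [1]\<close> and only \<open>b\<close> remains open.\<close>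
      have "xs = []"
      proof (cases xs)
        case (Cons y ys)
        then have "count_list \<mu> 1 \<ge> 2" using 4 by (simp add: xs)
        then show ?thesis using \<phi> 4 by (simp add: b F_set_def)
      qed
      show ?thesis
      proof (cases b)
        case True
        have "(False, []) \<in> F_set (n - 2 * int (Suc m)) m (k - 1)"
          using \<phi> True by (auto simp: b xs \<open>xs = []\<close> F_set_def 4)
        moreover have "\<phi> = F_add_odd m (False, [])"
          using 4 True by (simp add: b xs \<open>xs = []\<close> F_add_odd_def)
        ultimately show ?thesis by blast
      next
        case False
        have "(False, []) \<in> F_set (n - 1) m k"
          using \<phi> False by (auto simp: b xs \<open>xs = []\<close> F_set_def 4)
        moreover have "\<phi> = F_add_one (False, [])"
          using False by (simp add: b xs \<open>xs = []\<close> F_add_one_def)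
        ultimately show ?thesis by blast
      qed
    qed
  qed
qed

lemma F_set_bound: "(b, \<mu>) \<in> F_set n m k \<Longrightarrow> p \<in> set \<mu> \<Longrightarrow> p \<le> 2 * m"
  by (auto simp: F_set_def)

lemma card_F_set: "card (F_set n m k) = rec_count n m k"
proof -
  have "finite (F_set n m k) \<and> card (F_set n m k) = rec_count n m k"
  proof (rule card_eq_rec_count[OF _ F_set_0 F_set_Suc])
    fix n m k
    show "F_set n m k = {}" if "n < 0"
      using that by (auto simp: F_set_def)
    show "inj_on F_add_one (F_set n m k)"
      by (auto simp: inj_on_def F_add_one_def)
    show "inj_on (F_add_even m) (F_set n (Suc m) k)"
      by (auto simp: inj_on_def F_add_even_def)
    show "inj_on (F_add_odd m) (F_set n m k)"
      \<comment> \<open>For \<open>m = 0\<close> the map forgets \<open>b\<close>, but then its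
        domain has at most one element.\<close>
      by (cases "m = 0") (auto simp: inj_on_def F_add_odd_def F_set_0)
  next
    fix n n' k k' :: int and m :: nat
    \<comment> \<open>The parts \<open>2 * m + 2\<close> and \<open>2 * m + 1\<close> exceed the
      bound \<open>2 * m\<close>, so \<open>F_add_one\<close> never produces a list containing
      them.\<close>
    have new: "2 * Suc m \<notin> set \<mu>" "Suc (2 * m) \<notin> set \<mu>" if "(b, \<mu>) \<in> F_set n m k" for b \<mu> n k
      using F_set_bound[OF that] by fastforce+
    show "F_add_one ` F_set n m k \<inter> F_add_even m ` F_set n' (Suc m) k' = {}"
      using new(1) by (fastforce simp: F_add_one_def F_add_even_def dest: arg_cong[of _ _ set])
    show "F_add_one ` F_set n m k \<inter> F_add_odd m ` F_set n' m k' = {}"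
    proof (cases "m = 0")
      case True
      \<comment> \<open>Here both images can contain only the list \<open>[1]\<close>, and the flag
        tells them apart.\<close>
      then show ?thesis by (auto simp: F_set_0 F_add_one_def F_add_odd_def)
    next
      case False
      then show ?thesis
        using new(2) by (fastforce simp: F_add_one_def F_add_odd_def dest: arg_cong[of _ _ set])
    qed
    show "F_add_even m ` F_set n (Suc m) k \<inter> F_add_odd m ` F_set n' m k' = {}"
      by (cases "m = 0") (auto simp: F_add_even_def F_add_odd_def F_set_0)
  qed
  then show ?thesis ..
qed

lemma F_eq_rec_count: "F n m k = rec_count (int n) m (int k)"
proof -
  have "{\<phi> \<in> \<F> n. ell_1 \<phi> = m \<and> ell_o_bar \<phi> = k} = F_set (int n) m (int k)" (is "?L = ?R")
  proof (intro set_eqI iffI)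
    fix \<phi> assume \<phi>: "\<phi> \<in> ?L"
    obtain b \<mu> where b: "\<phi> = (b, \<mu>)" by force
    have "count_list \<mu> 1 > 0" if b
      using \<phi> that by (auto simp: b \<F>_def count_list_0_iff intro!: gr0I)
    then show "\<phi> \<in> ?R"
      using \<phi> by (auto simp: b \<F>_def F_set_def ell_1_def ell_o_bar_def is_partition_def)
  next
    fix \<phi> assume \<phi>: "\<phi> \<in> ?R"
    obtain b \<mu> where b: "\<phi> = (b, \<mu>)" by force
    have "1 \<in> set \<mu>" if "b \<or> \<mu> \<noteq> []"
    proof (cases m)
      case 0
      then show ?thesis using \<phi> that by (auto simp: b F_set_0 split: if_splits)
    next
      case (Suc m')
      then show ?thesis using \<phi> F_set_SucE unfolding b by (metis in_set_conv_decomp)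
    qed
    then show "\<phi> \<in> ?L"
      using \<phi> by (auto simp: b \<F>_def F_set_def ell_1_def ell_o_bar_def is_partition_def)
  qed
  then show ?thesis
    by (simp add: F_def card_F_set)
qed

section \<open>Signed partitions\<close>

text \<open>Oddness makes the negative parts positive, and \<open>p < 2 * m\<close> states their
  bound without a subtraction.\<close>

definition signed_set :: "int \<Rightarrow> nat \<Rightarrow> int \<Rightarrow> (nat list \<times> nat list) set" where
  "signed_set n m k = {(\<pi>, \<nu>). sorted_wrt (\<ge>) \<pi> \<and> (\<forall>p\<in>set \<pi>. 0 < p \<and> even p) \<and> distinct \<pi> \<and>
     sorted_wrt (\<ge>) \<nu> \<and> (\<forall>p\<in>set \<nu>. odd p \<and> p < 2 * m) \<and> distinct \<nu> \<and>
     int (sum_list \<pi>) - int (sum_list \<nu>) = n \<and> length \<pi> = m \<and> int m - int (length \<nu>) = k}"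

text \<open>The extreme case is \<open>2 + 4 + ... + 2 * l\<close> for length \<open>l\<close>. The
  bound on the head carries the induction: consecutive distinct even parts differ by at least
  2.\<close>

lemma sum_list_distinct_even_ge:
  assumes "sorted_wrt (\<ge>) \<pi>" "\<forall>p\<in>set \<pi>. 0 < p \<and> even (p :: nat)" "distinct \<pi>"
  shows "sum_list \<pi> \<ge> length \<pi> * (length \<pi> + 1) \<and> (\<pi> \<noteq> [] \<longrightarrow> hd \<pi> \<ge> 2 * length \<pi>)"
  using assms
proof (induction \<pi>)
  case (Cons x \<pi>)
  have "x \<ge> 2 * Suc (length \<pi>)"
  proof (cases \<pi>)
    case Nil
    then show ?thesis using Cons.prems by (auto elim: evenE)
  next
    case (Cons y ys)
    have "y < x" "even x" "even y" "y \<ge> 2 * length \<pi>"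
      using Cons.IH Cons.prems Cons by auto
    then show ?thesis by (auto elim!: evenE)
  qed
  then show ?case using Cons by (auto simp: algebra_simps)
qed simp

text \<open>The extreme case is \<open>1 + 3 + ... + (2 * m - 1)\<close>, which is the square of
  \<open>m\<close>.\<close>

lemma sum_list_distinct_odd_le:
  assumes "\<forall>p\<in>set \<nu>. odd p \<and> p < 2 * (m :: nat)" "distinct \<nu>"
  shows "sum_list \<nu> \<le> m * m"
proof -
  have sub: "set \<nu> \<subseteq> (\<lambda>i. 2 * i + 1) ` {..<m}"
    using assms(1) by (force elim!: oddE)
  have "sum_list \<nu> = \<Sum>(set \<nu>)"
    using assms(2) by (simp add: distinct_sum_list_conv_Sum)
  also have "\<dots> \<le> \<Sum>((\<lambda>i. 2 * i + 1) ` {..<m})"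
    by (rule sum_mono2) (use sub in auto)
  also have "\<dots> = (\<Sum>i<m. 2 * i + 1)"
    by (simp add: sum.reindex inj_on_def)
  also have "\<dots> = m * m"
    by (induction m) auto
  finally show ?thesis .
qed

text \<open>A difference of sums could be negative; the bounds \<open>m * (m + 1)\<close> from below
  and \<open>m * m\<close> from above prevent this.\<close>

lemma signed_set_neg:
  assumes "n < 0"
  shows "signed_set n m k = {}"
proof -
  have False if "(\<pi>, \<nu>) \<in> signed_set n m k" for \<pi> \<nu>
  proof -
    have "sum_list \<pi> \<ge> m * (m + 1)" "sum_list \<nu> \<le> m * m"
      using that sum_list_distinct_even_ge[of \<pi>] sum_list_distinct_odd_le[of \<nu> m]
      by (auto simp: signed_set_def)
    then have "sum_list \<nu> \<le> sum_list \<pi>"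
      by (simp add: algebra_simps)
    then show False
      using that assms by (simp add: signed_set_def)
  qed
  then show ?thesis by auto
qed

lemma signed_set_shift:
  assumes "\<forall>p\<in>set \<pi>. 0 < p"
  shows "(shift \<pi>, \<nu>) \<in> signed_set n m k \<longleftrightarrow> (\<pi>, \<nu>) \<in> signed_set (n - 2 * int m) m k"
  using assms by (auto simp: signed_set_def)

lemma signed_set_shift_append2:
  assumes "\<forall>p\<in>set \<pi>. 0 < p" "\<forall>p\<in>set \<nu>. p < 2 * m"
  shows "(shift \<pi> @ [2], \<nu>) \<in> signed_set n (Suc m) k
    \<longleftrightarrow> (\<pi>, \<nu>) \<in> signed_set (n - 2 * int (Suc m)) m (k - 1)"
  using assms by (fastforce simp: signed_set_def sorted_wrt_append)

text \<open>The positive side gains \<open>2 * m + 2\<close> and the negative side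
  \<open>2 * m + 1\<close>, a net change of 1. Both lengths grow by one, so \<open>k\<close> is
  unchanged.\<close>

lemma signed_set_shift_append2_Cons:
  assumes "\<forall>p\<in>set \<pi>. 0 < p" "\<forall>p\<in>set \<nu>. p < 2 * m"
  shows "(shift \<pi> @ [2], Suc (2 * m) # \<nu>) \<in> signed_set n (Suc m) k
    \<longleftrightarrow> (\<pi>, \<nu>) \<in> signed_set (n - 1) m k"
  using assms by (fastforce simp: signed_set_def sorted_wrt_append)

lemma signed_set_bounds:
  assumes "(\<pi>, \<nu>) \<in> signed_set n m k"
  shows "\<forall>p\<in>set \<pi>. 0 < p" "\<forall>p\<in>set \<nu>. p < 2 * m"
  using assms by (auto simp: signed_set_def)

lemma signed_set_Suc:
  "signed_set n (Suc m) k
    = (\<lambda>(\<pi>, \<nu>). (shift \<pi> @ [2], Suc (2 * m) # \<nu>)) ` signed_set (n - 1) m k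
    \<union> (\<lambda>(\<pi>, \<nu>). (shift \<pi>, \<nu>)) ` signed_set (n - 2 * int (Suc m)) (Suc m) k
    \<union> (\<lambda>(\<pi>, \<nu>). (shift \<pi> @ [2], \<nu>)) ` signed_set (n - 2 * int (Suc m)) m (k - 1)"
  (is "?L = ?A \<union> ?B \<union> ?C")
proof
  show "?A \<union> ?B \<union> ?C \<subseteq> ?L"
    using signed_set_shift signed_set_shift_append2 signed_set_shift_append2_Cons signed_set_bounds
    by fast
  show "?L \<subseteq> ?A \<union> ?B \<union> ?C"
  proof
    fix \<sigma> assume \<sigma>: "\<sigma> \<in> ?L"
    obtain \<pi> \<nu> where eq: "\<sigma> = (\<pi>, \<nu>)" by force
    have "length \<pi> = Suc m" using \<sigma> by (simp add: eq signed_set_def)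
    then obtain xs x where xs: "\<pi> = xs @ [x]"
      by (cases \<pi> rule: rev_cases) auto
    have gt: "\<forall>p\<in>set xs. p > x" and "x > 0" "even x"
      using \<sigma> by (force simp: eq signed_set_def xs sorted_wrt_append order.order_iff_strict)+
    show "\<sigma> \<in> ?A \<union> ?B \<union> ?C"
    proof (cases "x = 2")
      case True
      have "\<forall>p\<in>set xs. p \<ge> 3" using gt True by auto
      then obtain ys where ys: "xs = shift ys" "\<forall>p\<in>set ys. p > 0"
        by (rule shift_preimage)
      have \<nu>: "sorted_wrt (\<ge>) \<nu>" "distinct \<nu>" "\<forall>p\<in>set \<nu>. odd p \<and> p < 2 * Suc m"
        using \<sigma> by (auto simp: eq signed_set_def)
      \<comment> \<open>Parity excludes \<open>2 * m\<close>, so \<open>2 * m + 1\<close> is the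
        only negative part that the bound for \<open>m\<close> forbids.\<close>
      have small: "p < 2 * m" if "p \<in> set \<nu>" "p \<noteq> Suc (2 * m)" for p
      proof -
        have "odd p" "p < 2 * Suc m" using that \<nu>(3) by auto
        then show ?thesis using that(2) by (cases "p = 2 * m") auto
      qed
      show ?thesis
      proof (cases "Suc (2 * m) \<in> set \<nu>")
        case True
        then obtain z zs where zs: "\<nu> = z # zs" by (cases \<nu>) auto
        \<comment> \<open>This is the largest admissible negative part, hence the head of the
          nonincreasing list.\<close>
        have "z = Suc (2 * m)"
          using True \<nu> by (auto simp: zs)
        then have "(ys, zs) \<in> signed_set (n - 1) m k"
          using \<sigma> small \<nu>(2) ys(2) signed_set_shift_append2_Cons[of ys zs m n k]
          by (auto simp: eq xs ys(1) \<open>x = 2\<close> zs)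
        then show ?thesis
          by (force simp: eq xs ys(1) \<open>x = 2\<close> zs \<open>z = Suc (2 * m)\<close>)
      next
        case False
        then have "\<forall>p\<in>set \<nu>. p < 2 * m" using small by metis
        then have "(ys, \<nu>) \<in> signed_set (n - 2 * int (Suc m)) m (k - 1)"
          using \<sigma> ys(2) signed_set_shift_append2[of ys \<nu> m n k]
          by (simp add: eq xs ys(1) \<open>x = 2\<close>)
        then show ?thesis
          by (force simp: eq xs ys(1) \<open>x = 2\<close>)
      qed
    next
      case False
      then have "x \<ge> 3" using \<open>x > 0\<close> \<open>even x\<close> by (auto elim!: evenE)
      then have "\<forall>p\<in>set \<pi>. p \<ge> 3" using gt by (auto simp: xs)
      then obtain ys where ys: "\<pi> = shift ys" "\<forall>p\<in>set ys. p > 0"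
        by (rule shift_preimage)
      then have "(ys, \<nu>) \<in> signed_set (n - 2 * int (Suc m)) (Suc m) k"
        using \<sigma> signed_set_shift[of ys \<nu> n "Suc m" k] unfolding eq ys(1) by blast
      then show ?thesis
        by (force simp: eq ys(1))
    qed
  qed
qed

lemma card_signed_set: "card (signed_set n m k) = rec_count n m k"
proof -
  have "finite (signed_set n m k) \<and> card (signed_set n m k) = rec_count n m k"
  proof (rule card_eq_rec_count[where S = signed_set
        and f = "\<lambda>m (\<pi>, \<nu>). (shift \<pi> @ [2], Suc (2 * m) # \<nu>)"
        and g = "\<lambda>_ (\<pi>, \<nu>). (shift \<pi>, \<nu>)" and h = "\<lambda>_ (\<pi>, \<nu>). (shift \<pi> @ [2], \<nu>)",
        OF signed_set_neg _ signed_set_Suc])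
    fix n k
    show "signed_set n 0 k = (if n = 0 \<and> k = 0 then {([], [])} else {})"
      by (auto simp: signed_set_def)
  next
    fix n n' k k' :: int and m :: nat
    have neq: "shift \<pi> \<noteq> xs @ [2]" if "(\<pi>, \<nu>) \<in> signed_set n m k" for \<pi> \<nu> xs n m k
      using that by (intro shift_neq_append) (auto dest: signed_set_bounds(1))
    show "(\<lambda>(\<pi>, \<nu>). (shift \<pi> @ [2], Suc (2 * m) # \<nu>)) ` signed_set n m k
        \<inter> (\<lambda>(\<pi>, \<nu>). (shift \<pi>, \<nu>)) ` signed_set n' (Suc m) k' = {}"
      using neq by (auto dest!: sym[of "_ @ _"])
    show "(\<lambda>(\<pi>, \<nu>). (shift \<pi>, \<nu>)) ` signed_set n (Suc m) k
        \<inter> (\<lambda>(\<pi>, \<nu>). (shift \<pi> @ [2], \<nu>)) ` signed_set n' m k' = {}"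
      using neq by (auto dest!: sym[of "_ @ _"])
    \<comment> \<open>The positive parts may coincide; the negative part \<open>2 * m + 1\<close>
      occurs in the first image only.\<close>
    show "(\<lambda>(\<pi>, \<nu>). (shift \<pi> @ [2], Suc (2 * m) # \<nu>)) ` signed_set n m k
        \<inter> (\<lambda>(\<pi>, \<nu>). (shift \<pi> @ [2], \<nu>)) ` signed_set n' m k' = {}"
      by (fastforce dest: signed_set_bounds(2))
  qed (auto simp: inj_on_def)
  then show ?thesis ..
qed

lemma F_neg1_eq_rec_count: "F_neg1 n m k = rec_count (int n) m (int k)"
proof -
  have "{(\<pi>, \<nu>). signed_partition (\<pi>, \<nu>) (int n) \<and> (\<forall>p\<in>set \<pi>. even p) \<and> distinct \<pi> \<and>
      (\<forall>p\<in>set \<nu>. odd p \<and> int p \<le> 2 * int (length \<pi>) - 1) \<and> distinct \<nu> \<and>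
      length \<pi> = m \<and> int (length \<pi>) - int (length \<nu>) = int k} = signed_set (int n) m (int k)"
    by (fastforce simp: signed_set_def signed_partition_def is_partition_def intro: odd_pos)
  then show ?thesis
    by (simp add: F_neg1_def card_signed_set)
qed

theorem theorem1p3:
  fixes n m k :: nat
  shows "ped n m k = F n m k \<and> F n m k = F_neg1 n m k"
  by (simp add: ped_eq_rec_count F_eq_rec_count F_neg1_eq_rec_count)

end
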